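(* There exists a constant $c\ge1$, depending only on $\mathit{data}$ (in particular not on $\theta$, $\Lambda$, $i$), such that the following holds in the setting described in the context: if $i\in\Theta_2$ and $50U_i\cap\mathcal Q_2\ne\emptyset$, then $$\rho_2-\rho_1\le c\,\theta^{\frac{2-q}p}\,r_i .$$
   Context: Setting. $n\ge2$, $N\ge1$, $\alpha\in(0,1]$, $2<p<q<p+\frac{2\alpha}{n+2}$; $\Omega\subset\mathbb R^n$ bounded domain, $T>0$, $\Omega_T=\Omega\times(0,T)$. $a:\Omega_T\to[0,\infty)$ bounded with $|a(x,t)-a(y,s)|\le[a]_\alpha\max\{|x-y|^\alpha,|t-s|^{\alpha/2}\}$. $\mathcal A:\Omega_T\times\mathbb R^{Nn}\to\mathbb R^{Nn}$ is Carathéodory with $\mathcal A(z,\xi)\cdot\xi\ge L_1(|\xi|^p+a(z)|\xi|^q)$, $|\mathcal A(z,\xi)|\le L_2(|\xi|^{p-1}+a(z)|\xi|^{q-1})$, $0<L_1\le L_2<\infty$. $H(z,s)=s^p+a(z)s^q$; $F:\Omega_T\to\mathbb R^{Nn}$ measurable, $H(z,|F|)\in L^1(\Omega_T)$. $u$ is a very weak solution with deficit $\delta\in(0,1)$, where $\delta>\frac{q-1}p$ and $2-q(1-\delta)>0$: $u\in L^1(0,T;W^{1,1}(\Omega,\mathbb R^N))$, $\iint_{\Omega_T}H(z,|\nabla u|)^\delta dz<\infty$ and $\iint_{\Omega_T}(-u\cdot\varphi_t+\mathcal A(z,\nabla u)\cdot\nabla\varphi)\,dz=\iint_{\Omega_T}(|F|^{p-2}F+a|F|^{q-2}F)\cdot\nabla\varphi\,dz$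 for all $\varphi\in C_0^\infty(\Omega_T,\mathbb R^N)$. $\mathit{data}=(n,N,p,q,\alpha,L_1,L_2,[a]_\alpha)$. $(f)_E=f_E=\frac1{|E|}\iint_Ef\,dz$. Cylinders, with $z_0=(x_0,t_0)$: $Q_r(z_0)=B_r(x_0)\times(t_0-r^2,t_0+r^2)$; $Q_r^\lambda(z_0)=B_r(x_0)\times(t_0-\lambda^{2-p}r^2,t_0+\lambda^{2-p}r^2)$; $G_r^\lambda(z_0)=B_r(x_0)\times\big(t_0-\frac{\lambda^2}{H(z_0,\lambda)}r^2,t_0+\frac{\lambda^2}{H(z_0,\lambda)}r^2\big)$; $kQ_r^\lambda=Q_{kr}^\lambda$, $kG_r^\lambda=G_{kr}^\lambda$ for $k>0$. Underlying intrinsic cylinder. Fix $z_0\in\Omega_T$, $\rho>0$, $\pi>1$, $\Pi=\pi^p+a(z_0)\pi^q$, such that one of the following holds. ($p$-intrinsic) $Q_{16\rho}^\pi(z_0)\subset\Omega_T$, $\pi^p\ge a(z_0)\pi^q$, $\rho^\alpha\le\pi^{p-q}$ and $((H(z,|\nabla u|)+H(z,|F|))^\delta)_{Q_{16\rho}^\pi(z_0)}\le\pi^{\delta p}\le((H(z,|\nabla u|)+H(z,|F|))^\delta)_{Q_\rho^\pi(z_0)}$. ($(p,q)$-intrinsic) $G_{16\rho}^\pi(z_0)\subset\Omega_T$, $\pi^p<a(z_0)\pi^q$, $\frac{a(z_0)}2\le a(z)\le2a(z_0)$ for all $z\in Q_{10\rho}(z_0)\cap\Omega_T$, and $((H(z,|\nabla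 u|)+H(z,|F|))^\delta)_{G_{16\rho}^\pi(z_0)}\le\Pi^\delta\le((H(z,|\nabla u|)+H(z,|F|))^\delta)_{G_\rho^\pi(z_0)}$. Let $\rho\le\rho_1<\rho_2\le4\rho$, and for $i=1,2$ let $\mathcal Q_i=Q_{\rho_i}^\pi(z_0)$ in the $p$-intrinsic and $\mathcal Q_i=G_{\rho_i}^\pi(z_0)$ in the $(p,q)$-intrinsic case, with time interval $(t_0-\sigma_i,t_0+\sigma_i)$. Extension of $a$. From now on $a$ denotes the function on $\mathbb R^{n+1}$ given by $\max\{\min\{\tilde a,\sup_{\mathcal Q_2}a\},\inf_{\mathcal Q_2}a\}$, $\tilde a(x,t)=\inf_{(y,s)\in\mathcal Q_2}\{a(y,s)+[a]_\alpha(|x-y|^\alpha+|t-s|^{\alpha/2})\}$; it agrees with the original $a$ on $\mathcal Q_2$, and $H$ and $G_r^\lambda$ below are formed with it. Bad set and Whitney cylinders. Let $\theta\in(0,1)$, $\Lambda\ge\theta\Pi$. Put $g=(|\nabla u|+\frac{|u-u_{\mathcal Q_2}|}\rho+|F|)\chi_{\mathcal Q_2}$, $\Upsilon=(M(g^{q-1}+(ag^q)^{\frac{q-1}p}))^{\frac p{q-1}}$, where $Mf(z)=\sup_{Q\ni z}\frac1{|Q|}\iint_Q|f|$ over all cylinders $Q=B_r(y)\times(\tau-s,\tau+s)$, $r,s>0$, containing $z$; $E(\Lambda)=\{z\in\mathbb R^{n+1}:\Upsilon(z)\le\Lambda\}$ and $E(\Lambda)^c$ is its complement (an open set of finite measure),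 assumed nonempty. For $z\in E(\Lambda)^c$, $\lambda_z$ is the unique positive number with $\lambda_z^p+a(z)\lambda_z^q=\Lambda$; it is assumed that $\Pi$ is so large (depending on $\theta$) that all $\lambda_z>1$. Let $d_z(z_1,z_2)=\max\{|x_1-x_2|,\sqrt{\lambda_z^{p-2}|t_1-t_2|}\}$ if $\lambda_z^p\ge a(z)\lambda_z^q$ and $d_z(z_1,z_2)=\max\{|x_1-x_2|,\sqrt{\Lambda\lambda_z^{-2}|t_1-t_2|}\}$ otherwise; $4r_z=\inf_{w\in E(\Lambda)}d_z(z,w)$; and $U_z=Q_{r_z}^{\lambda_z}(z)$ if $\lambda_z^p\ge a(z)\lambda_z^q$, $U_z=G_{r_z}^{\lambda_z}(z)$ otherwise. $\{U_i\}_{i\in\mathbb N}$ is a Whitney covering of $E(\Lambda)^c$ by such cylinders: $U_i=U_{z_i}$ with $z_i\in E(\Lambda)^c$, $r_i=r_{z_i}$, $\lambda_i=\lambda_{z_i}$, such that $\bigcup_iU_i=E(\Lambda)^c$, the $\frac18U_i$ are pairwise disjoint, $4U_i\subset E(\Lambda)^c$, $5U_i\cap E(\Lambda)\ne\emptyset$; if $U_i$ is of $Q$-type then $r_i^\alpha\lambda_i^q\le\frac1{800(1+[a]_\alpha)}\lambda_i^p$; and if $U_i$ is of $G$-type then $\frac{a(z_i)}2\le a(z)\le2a(z_i)$ for all $z\in Q_{200r_i}(z_i)$. Index sets. $\mathcal C_1=\mathbb R^n\times(t_0-\frac{4\sigma_1+\sigma_2}5,t_0+\frac{4\sigma_1+\sigma_2}5)$,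 $\mathcal C_2=\mathbb R^n\times(t_0-\frac{3\sigma_1+2\sigma_2}5,t_0+\frac{3\sigma_1+2\sigma_2}5)$, $\Theta=\{i:50U_i\cap\mathcal C_1\ne\emptyset\}$, $\Theta_1=\{i\in\Theta:50U_i\subset\mathcal C_2\}$, $\Theta_2=\Theta\setminus\Theta_1$. *)

theory Defs
  imports "HOL-Analysis.Analysis"
begin

text \<open>
  Space-time points are pairs (x, t) of type \<open>(real^'n) \<times> real\<close>. Gradients of maps into
  \<open>real^'m\<close> are matrices of type \<open>real^'n^'m\<close> (row index: component of the map), whose library
  norm and inner product are the Euclidean ones on \<open>\<real>\<^sup>N\<^sup>n\<close>. The library product norm
  on space-time is never used.
\<close>

type_synonym 'n spacetime = "(real^'n) \<times> real"

definition mean :: "'a::euclidean_space set \<Rightarrow> ('a \<Rightarrow> 'b::{banach, second_countable_topology}) \<Rightarrow> 'b"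
  where "mean E f = (LINT z:E|lebesgue. f z) /\<^sub>R measure lebesgue E"


subsection \<open>Test functions and Sobolev spaces\<close>

primrec C_times :: "nat \<Rightarrow> ('a::euclidean_space \<Rightarrow> 'b::real_normed_vector) \<Rightarrow> bool" where
  "C_times 0 f \<longleftrightarrow> continuous_on UNIV f"
| "C_times (Suc k) f \<longleftrightarrow>
     (\<forall>x. f differentiable (at x)) \<and> (\<forall>v. C_times k (\<lambda>x. frechet_derivative f (at x) v))"

definition test_function :: "'a::euclidean_space set \<Rightarrow> ('a \<Rightarrow> 'b::real_normed_vector) \<Rightarrow> bool" where
  "test_function S \<phi> \<longleftrightarrow>
     (\<forall>k. C_times k \<phi>) \<and> compact (closure {x. \<phi> x \<noteq> 0}) \<and> closure {x. \<phi> x \<noteq> 0} \<subseteq> S"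

definition weak_gradient ::
    "(real^'n) set \<Rightarrow> (real^'n \<Rightarrow> real^'m) \<Rightarrow> (real^'n \<Rightarrow> real^'n^'m) \<Rightarrow> bool" where
  "weak_gradient \<Omega> v Dv \<longleftrightarrow>
     (\<forall>\<phi> :: real^'n \<Rightarrow> real. test_function \<Omega> \<phi> \<longrightarrow>
       (\<forall>j i. (LINT x:\<Omega>|lebesgue. v x $ j * frechet_derivative \<phi> (at x) (axis i 1))
              = - (LINT x:\<Omega>|lebesgue. Dv x $ j $ i * \<phi> x)))"

definition W11 ::
    "(real^'n) set \<Rightarrow> (real^'n \<Rightarrow> real^'m) \<Rightarrow> (real^'n \<Rightarrow> real^'n^'m) \<Rightarrow> bool" where
  "W11 \<Omega> v Dv \<longleftrightarrow>
     set_integrable lebesgue \<Omega> v \<and> set_integrable lebesgue \<Omega> Dv \<and> weak_gradient \<Omega> v Dv"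

definition W11_norm ::
    "(real^'n) set \<Rightarrow> (real^'n \<Rightarrow> real^'m) \<Rightarrow> (real^'n \<Rightarrow> real^'n^'m) \<Rightarrow> real" where
  "W11_norm \<Omega> v Dv = (LINT x:\<Omega>|lebesgue. norm (v x)) + (LINT x:\<Omega>|lebesgue. norm (Dv x))"

text \<open>
  Membership of \<open>u\<close> in \<open>L\<^sup>1(0,T; W\<^sup>1\<^sup>,\<^sup>1(\<Omega>, \<real>\<^sup>N))\<close> with spatial weak gradient
  \<open>Du\<close>. Strongly measurable \<open>W\<^sup>1\<^sup>,\<^sup>1\<close>-valued maps of time are represented by jointly
  measurable functions on \<open>\<Omega> \<times> (0,T)\<close>.
\<close>

definition L1_W11 ::
    "(real^'n) set \<Rightarrow> real \<Rightarrow> ('n spacetime \<Rightarrow> real^'m) \<Rightarrow> ('n spacetime \<Rightarrow> real^'n^'m) \<Rightarrow> bool" where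
  "L1_W11 \<Omega> T u Du \<longleftrightarrow>
     u \<in> borel_measurable (lebesgue_on (\<Omega> \<times> {0<..<T})) \<and>
     Du \<in> borel_measurable (lebesgue_on (\<Omega> \<times> {0<..<T})) \<and>
     (AE t in lebesgue_on {0<..<T}. W11 \<Omega> (\<lambda>x. u (x, t)) (\<lambda>x. Du (x, t))) \<and>
     set_integrable lebesgue {0<..<T} (\<lambda>t. W11_norm \<Omega> (\<lambda>x. u (x, t)) (\<lambda>x. Du (x, t)))"

definition time_deriv :: "('n::finite spacetime \<Rightarrow> real^'m) \<Rightarrow> 'n spacetime \<Rightarrow> real^'m" where
  "time_deriv \<phi> z = frechet_derivative \<phi> (at z) (0, 1)"

definition space_grad :: "('n::finite spacetime \<Rightarrow> real^'m) \<Rightarrow> 'n spacetime \<Rightarrow> real^'n^'m" where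
  "space_grad \<phi> z = (\<chi> j i. frechet_derivative \<phi> (at z) (axis i 1, 0) $ j)"


subsection \<open>The double phase system\<close>

definition H :: "('n spacetime \<Rightarrow> real) \<Rightarrow> real \<Rightarrow> real \<Rightarrow> 'n spacetime \<Rightarrow> real \<Rightarrow> real" where
  "H a p q z s = s powr p + a z * s powr q"

definition admissible_coefficient ::
    "real \<Rightarrow> real \<Rightarrow> 'n::finite spacetime set \<Rightarrow> ('n spacetime \<Rightarrow> real) \<Rightarrow> bool" where
  "admissible_coefficient \<alpha> a\<^sub>\<alpha> S a \<longleftrightarrow>
     (\<forall>z\<in>S. 0 \<le> a z) \<and> bounded (a ` S) \<and>
     (\<forall>(x, t)\<in>S. \<forall>(y, s)\<in>S.
        \<bar>a (x, t) - a (y, s)\<bar> \<le> a\<^sub>\<alpha> * max (norm (x - y) powr \<alpha>) (\<bar>t - s\<bar> powr (\<alpha> / 2)))"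

definition caratheodory ::
    "'a::euclidean_space set \<Rightarrow> ('a \<Rightarrow> 'b::euclidean_space \<Rightarrow> 'b) \<Rightarrow> bool" where
  "caratheodory S A \<longleftrightarrow>
     (\<forall>\<xi>. (\<lambda>z. A z \<xi>) \<in> borel_measurable (lebesgue_on S)) \<and>
     (AE z in lebesgue_on S. continuous_on UNIV (A z))"

definition double_phase_growth ::
    "real \<Rightarrow> real \<Rightarrow> real \<Rightarrow> real \<Rightarrow> 'n::finite spacetime set \<Rightarrow> ('n spacetime \<Rightarrow> real) \<Rightarrow>
     ('n spacetime \<Rightarrow> real^'n^'m \<Rightarrow> real^'n^'m) \<Rightarrow> bool" where
  "double_phase_growth p q L1 L2 S a A \<longleftrightarrow>
     (AE z in lebesgue_on S. \<forall>\<xi>.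
        A z \<xi> \<bullet> \<xi> \<ge> L1 * (norm \<xi> powr p + a z * norm \<xi> powr q) \<and>
        norm (A z \<xi>) \<le> L2 * (norm \<xi> powr (p - 1) + a z * norm \<xi> powr (q - 1)))"

definition very_weak_solution ::
    "real \<Rightarrow> real \<Rightarrow> real \<Rightarrow> (real^'n) set \<Rightarrow> real \<Rightarrow> ('n spacetime \<Rightarrow> real) \<Rightarrow>
     ('n spacetime \<Rightarrow> real^'n^'m \<Rightarrow> real^'n^'m) \<Rightarrow> ('n spacetime \<Rightarrow> real^'n^'m) \<Rightarrow>
     ('n spacetime \<Rightarrow> real^'m) \<Rightarrow> ('n spacetime \<Rightarrow> real^'n^'m) \<Rightarrow> bool" where
  "very_weak_solution p q \<delta> \<Omega> T a A F u Du \<longleftrightarrow>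
     L1_W11 \<Omega> T u Du \<and>
     set_integrable lebesgue (\<Omega> \<times> {0<..<T}) (\<lambda>z. H a p q z (norm (Du z)) powr \<delta>) \<and>
     (\<forall>\<phi> :: 'n spacetime \<Rightarrow> real^'m. test_function (\<Omega> \<times> {0<..<T}) \<phi> \<longrightarrow>
        (LINT z:\<Omega> \<times> {0<..<T}|lebesgue.
           - (u z \<bullet> time_deriv \<phi> z) + A z (Du z) \<bullet> space_grad \<phi> z)
        = (LINT z:\<Omega> \<times> {0<..<T}|lebesgue.
           (norm (F z) powr (p - 2) *\<^sub>R F z + (a z * norm (F z) powr (q - 2)) *\<^sub>R F z)
             \<bullet> space_grad \<phi> z))"


subsection \<open>Cylinders\<close>

definition cyl :: "'n::finite spacetime \<Rightarrow> real \<Rightarrow> real \<Rightarrow> 'n spacetime set" where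
  "cyl z r s = ball (fst z) r \<times> {snd z - s<..<snd z + s}"

definition par_cyl :: "real \<Rightarrow> 'n::finite spacetime \<Rightarrow> 'n spacetime set" where
  "par_cyl r z = cyl z r (r\<^sup>2)"

definition Q_cyl :: "real \<Rightarrow> real \<Rightarrow> real \<Rightarrow> 'n::finite spacetime \<Rightarrow> 'n spacetime set" where
  "Q_cyl p \<mu> r z = cyl z r (\<mu> powr (2 - p) * r\<^sup>2)"

definition G_cyl ::
    "('n spacetime \<Rightarrow> real) \<Rightarrow> real \<Rightarrow> real \<Rightarrow> real \<Rightarrow> real \<Rightarrow> 'n::finite spacetime \<Rightarrow> 'n spacetime set" where
  "G_cyl a p q \<mu> r z = cyl z r (\<mu>\<^sup>2 / H a p q z \<mu> * r\<^sup>2)"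

definition p_phase :: "('n spacetime \<Rightarrow> real) \<Rightarrow> real \<Rightarrow> real \<Rightarrow> real \<Rightarrow> 'n spacetime \<Rightarrow> bool" where
  "p_phase a p q \<mu> z \<longleftrightarrow> \<mu> powr p \<ge> a z * \<mu> powr q"

text \<open>
  The alternative between the two cylinder types, both for the underlying cylinder and for the
  Whitney cylinders; dilation by k replaces the radius r by k * r.
\<close>

definition intr_cyl ::
    "('n spacetime \<Rightarrow> real) \<Rightarrow> real \<Rightarrow> real \<Rightarrow> real \<Rightarrow> real \<Rightarrow> 'n::finite spacetime \<Rightarrow> 'n spacetime set" where
  "intr_cyl a p q \<mu> r z = (if p_phase a p q \<mu> z then Q_cyl p \<mu> r z else G_cyl a p q \<mu> r z)"

definition half_time ::
    "('n spacetime \<Rightarrow> real) \<Rightarrow> real \<Rightarrow> real \<Rightarrow> real \<Rightarrow> real \<Rightarrow> 'n spacetime \<Rightarrow> real" where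
  "half_time a p q \<mu> r z =
     (if p_phase a p q \<mu> z then \<mu> powr (2 - p) * r\<^sup>2 else \<mu>\<^sup>2 / H a p q z \<mu> * r\<^sup>2)"

definition p_intrinsic ::
    "real \<Rightarrow> real \<Rightarrow> real \<Rightarrow> real \<Rightarrow> 'n::finite spacetime set \<Rightarrow> ('n spacetime \<Rightarrow> real) \<Rightarrow>
     ('n spacetime \<Rightarrow> real^'n^'m) \<Rightarrow> ('n spacetime \<Rightarrow> real^'n^'m) \<Rightarrow>
     'n spacetime \<Rightarrow> real \<Rightarrow> real \<Rightarrow> bool" where
  "p_intrinsic p q \<alpha> \<delta> S a F Du z0 \<rho> \<pi> \<longleftrightarrow>
     (let f = (\<lambda>z. (H a p q z (norm (Du z)) + H a p q z (norm (F z))) powr \<delta>) in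
      Q_cyl p \<pi> (16 * \<rho>) z0 \<subseteq> S \<and>
      \<pi> powr p \<ge> a z0 * \<pi> powr q \<and>
      \<rho> powr \<alpha> \<le> \<pi> powr (p - q) \<and>
      mean (Q_cyl p \<pi> (16 * \<rho>) z0) f \<le> \<pi> powr (\<delta> * p) \<and>
      \<pi> powr (\<delta> * p) \<le> mean (Q_cyl p \<pi> \<rho> z0) f)"

definition pq_intrinsic ::
    "real \<Rightarrow> real \<Rightarrow> real \<Rightarrow> 'n::finite spacetime set \<Rightarrow> ('n spacetime \<Rightarrow> real) \<Rightarrow>
     ('n spacetime \<Rightarrow> real^'n^'m) \<Rightarrow> ('n spacetime \<Rightarrow> real^'n^'m) \<Rightarrow>
     'n spacetime \<Rightarrow> real \<Rightarrow> real \<Rightarrow> bool" where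
  "pq_intrinsic p q \<delta> S a F Du z0 \<rho> \<pi> \<longleftrightarrow>
     (let f = (\<lambda>z. (H a p q z (norm (Du z)) + H a p q z (norm (F z))) powr \<delta>) in
      G_cyl a p q \<pi> (16 * \<rho>) z0 \<subseteq> S \<and>
      \<pi> powr p < a z0 * \<pi> powr q \<and>
      (\<forall>z \<in> par_cyl (10 * \<rho>) z0 \<inter> S. a z0 / 2 \<le> a z \<and> a z \<le> 2 * a z0) \<and>
      mean (G_cyl a p q \<pi> (16 * \<rho>) z0) f \<le> H a p q z0 \<pi> powr \<delta> \<and>
      H a p q z0 \<pi> powr \<delta> \<le> mean (G_cyl a p q \<pi> \<rho> z0) f)"

definition extend_coeff ::
    "real \<Rightarrow> real \<Rightarrow> 'n::finite spacetime set \<Rightarrow> ('n spacetime \<Rightarrow> real) \<Rightarrow> 'n spacetime \<Rightarrow> real" where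
  "extend_coeff \<alpha> a\<^sub>\<alpha> Q2 a z =
     max (min (INF w\<in>Q2. a w + a\<^sub>\<alpha> * (norm (fst z - fst w) powr \<alpha> + \<bar>snd z - snd w\<bar> powr (\<alpha> / 2)))
              (SUP w\<in>Q2. a w))
         (INF w\<in>Q2. a w)"


subsection \<open>Bad set and Whitney cylinders\<close>

text \<open>The maximal function may be infinite, hence the values in \<^typ>\<open>ennreal\<close>.\<close>

definition maximal :: "('n::finite spacetime \<Rightarrow> real) \<Rightarrow> 'n spacetime \<Rightarrow> ennreal" where
  "maximal f z =
     (SUP Q \<in> {Q. z \<in> Q \<and> (\<exists>w r s. 0 < r \<and> 0 < s \<and> Q = cyl w r s)}.
        (\<integral>\<^sup>+w\<in>Q. ennreal \<bar>f w\<bar> \<partial>lebesgue) / emeasure lebesgue Q)"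

definition ennpowr :: "ennreal \<Rightarrow> real \<Rightarrow> ennreal" where
  "ennpowr x s = (if x = top then top else ennreal (enn2real x powr s))"

definition g_fun ::
    "('n spacetime \<Rightarrow> real^'m) \<Rightarrow> ('n spacetime \<Rightarrow> real^'n^'m) \<Rightarrow> ('n spacetime \<Rightarrow> real^'n^'m) \<Rightarrow>
     real \<Rightarrow> 'n::finite spacetime set \<Rightarrow> 'n spacetime \<Rightarrow> real" where
  "g_fun u Du F \<rho> Q2 z =
     (norm (Du z) + norm (u z - mean Q2 u) / \<rho> + norm (F z)) * indicator Q2 z"

definition Upsilon ::
    "real \<Rightarrow> real \<Rightarrow> ('n spacetime \<Rightarrow> real) \<Rightarrow> ('n::finite spacetime \<Rightarrow> real) \<Rightarrow> 'n spacetime \<Rightarrow> ennreal" where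
  "Upsilon p q a g z =
     ennpowr (maximal (\<lambda>w. g w powr (q - 1) + (a w * g w powr q) powr ((q - 1) / p)) z) (p / (q - 1))"

definition good_set ::
    "real \<Rightarrow> real \<Rightarrow> ('n spacetime \<Rightarrow> real) \<Rightarrow> ('n::finite spacetime \<Rightarrow> real) \<Rightarrow> real \<Rightarrow> 'n spacetime set" where
  "good_set p q a g \<Lambda> = {z. Upsilon p q a g z \<le> ennreal \<Lambda>}"

definition lam :: "('n spacetime \<Rightarrow> real) \<Rightarrow> real \<Rightarrow> real \<Rightarrow> real \<Rightarrow> 'n spacetime \<Rightarrow> real" where
  "lam a p q \<Lambda> z = (THE \<mu>. 0 < \<mu> \<and> \<mu> powr p + a z * \<mu> powr q = \<Lambda>)"

definition intr_dist ::
    "('n spacetime \<Rightarrow> real) \<Rightarrow> real \<Rightarrow> real \<Rightarrow> real \<Rightarrow> 'n::finite spacetime \<Rightarrow>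
     'n spacetime \<Rightarrow> 'n spacetime \<Rightarrow> real" where
  "intr_dist a p q \<Lambda> z z1 z2 =
     (let \<mu> = lam a p q \<Lambda> z in
      if p_phase a p q \<mu> z
      then max (norm (fst z1 - fst z2)) (sqrt (\<mu> powr (p - 2) * \<bar>snd z1 - snd z2\<bar>))
      else max (norm (fst z1 - fst z2)) (sqrt (\<Lambda> * \<mu> powr (-2) * \<bar>snd z1 - snd z2\<bar>)))"

definition whitney_radius ::
    "('n spacetime \<Rightarrow> real) \<Rightarrow> real \<Rightarrow> real \<Rightarrow> real \<Rightarrow> 'n::finite spacetime set \<Rightarrow> 'n spacetime \<Rightarrow> real" where
  "whitney_radius a p q \<Lambda> E z = (INF w\<in>E. intr_dist a p q \<Lambda> z z w) / 4"

text \<open>The dilated cylinder \<open>k U\<^sub>z\<close>.\<close>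

definition whitney_cyl ::
    "('n spacetime \<Rightarrow> real) \<Rightarrow> real \<Rightarrow> real \<Rightarrow> real \<Rightarrow> 'n::finite spacetime set \<Rightarrow>
     real \<Rightarrow> 'n spacetime \<Rightarrow> 'n spacetime set" where
  "whitney_cyl a p q \<Lambda> E k z = intr_cyl a p q (lam a p q \<Lambda> z) (k * whitney_radius a p q \<Lambda> E z) z"

definition whitney_covering ::
    "('n spacetime \<Rightarrow> real) \<Rightarrow> real \<Rightarrow> real \<Rightarrow> real \<Rightarrow> real \<Rightarrow> real \<Rightarrow> 'n::finite spacetime set \<Rightarrow>
     (nat \<Rightarrow> 'n spacetime) \<Rightarrow> bool" where
  "whitney_covering a p q \<alpha> a\<^sub>\<alpha> \<Lambda> E \<zeta> \<longleftrightarrow>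
     (let U = (\<lambda>k i. whitney_cyl a p q \<Lambda> E k (\<zeta> i));
          r = (\<lambda>i. whitney_radius a p q \<Lambda> E (\<zeta> i));
          \<mu> = (\<lambda>i. lam a p q \<Lambda> (\<zeta> i))
      in (\<forall>i. \<zeta> i \<in> - E) \<and>
         (\<Union>i. U 1 i) = - E \<and>
         disjoint_family (U (1 / 8)) \<and>
         (\<forall>i. U 4 i \<subseteq> - E) \<and>
         (\<forall>i. U 5 i \<inter> E \<noteq> {}) \<and>
         (\<forall>i. p_phase a p q (\<mu> i) (\<zeta> i) \<longrightarrow>
            r i powr \<alpha> * \<mu> i powr q \<le> 1 / (800 * (1 + a\<^sub>\<alpha>)) * \<mu> i powr p) \<and>
         (\<forall>i. \<not> p_phase a p q (\<mu> i) (\<zeta> i) \<longrightarrow>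
            (\<forall>z \<in> par_cyl (200 * r i) (\<zeta> i). a (\<zeta> i) / 2 \<le> a z \<and> a z \<le> 2 * a (\<zeta> i))))"


subsection \<open>Index sets\<close>

definition strip :: "real \<Rightarrow> real \<Rightarrow> 'n::finite spacetime set" where
  "strip t0 s = UNIV \<times> {t0 - s<..<t0 + s}"

definition Theta :: "(nat \<Rightarrow> 'n spacetime set) \<Rightarrow> 'n spacetime set \<Rightarrow> nat set" where
  "Theta U50 C1 = {i. U50 i \<inter> C1 \<noteq> {}}"

definition Theta1 ::
    "(nat \<Rightarrow> 'n spacetime set) \<Rightarrow> 'n spacetime set \<Rightarrow> 'n spacetime set \<Rightarrow> nat set" where
  "Theta1 U50 C1 C2 = {i \<in> Theta U50 C1. U50 i \<subseteq> C2}"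

definition Theta2 ::
    "(nat \<Rightarrow> 'n spacetime set) \<Rightarrow> 'n spacetime set \<Rightarrow> 'n spacetime set \<Rightarrow> nat set" where
  "Theta2 U50 C1 C2 = Theta U50 C1 - Theta1 U50 C1 C2"

end

theory Submission
  imports Defs
begin

text \<open>
  A cylinder \<open>50 U\<^sub>i\<close> with \<open>i \<in> \<Theta>\<^sub>2\<close> meets \<open>\<C>\<^sub>1\<close> and leaves \<open>\<C>\<^sub>2\<close>, so its time length, which is
  comparable to \<open>\<lambda>\<^sub>i\<^sup>2 r\<^sub>i\<^sup>2 / \<Lambda>\<close>, is at least \<open>(\<sigma>\<^sub>2 - \<sigma>\<^sub>1) / 5\<close>, and
  \<open>\<sigma>\<^sub>2 - \<sigma>\<^sub>1 \<ge> (\<pi>\<^sup>2 / \<Pi>) (\<rho>\<^sub>2 - \<rho>\<^sub>1)\<^sup>2\<close>. The extended coefficient takes values between the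
  extrema of \<open>a\<close> on \<open>\<Q>\<^sub>2\<close>, so the intrinsic conditions make \<open>H(z\<^sub>i, \<pi>)\<close> comparable to \<open>\<Pi>\<close>,
  and \<open>H(z\<^sub>i, \<lambda>\<^sub>i) = \<Lambda> \<ge> \<theta> \<Pi>\<close> is at least a constant multiple of \<open>\<theta> H(z\<^sub>i, \<pi>)\<close>.
  Since \<open>H(z\<^sub>i, t s) \<le> t\<^sup>p H(z\<^sub>i, s)\<close> for \<open>t \<le> 1\<close>, the quotient \<open>\<lambda>\<^sub>i / \<pi>\<close> is at least a constant
  multiple of \<open>\<theta>\<close> to the power \<open>1 / p\<close>. Since \<open>s\<^sup>2 / H(z\<^sub>i, s)\<close> decreases in \<open>s\<close>, and grows by at
  most the factor \<open>t\<close> to the power \<open>2 - q\<close> when \<open>s\<close> is replaced by \<open>t s\<close>, \<open>\<lambda>\<^sub>i\<^sup>2 / \<Lambda>\<close> is at most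
  \<open>\<pi>\<^sup>2 / \<Pi>\<close> times a constant multiple of \<open>\<theta>\<close> to the power \<open>(2 - q) / p\<close>.
\<close>

lemma H_strict_mono:
  assumes "0 \<le> a z" "0 < p" "0 < q" "0 \<le> x" "x < y"
  shows "H a p q z x < H a p q z y"
  unfolding H_def using assms
  by (intro add_less_le_mono mult_left_mono powr_mono2 powr_less_mono2) auto

lemma powr_le_H: "0 \<le> a z \<Longrightarrow> s powr p \<le> H a p q z s"
  by (simp add: H_def)

lemma H_pos: "0 \<le> a z \<Longrightarrow> 0 < s \<Longrightarrow> 0 < H a p q z s"
  by (simp add: H_def add_pos_nonneg)

lemma ex1_H_eq:
  assumes "0 \<le> a z" "0 < p" "0 < q" "0 < \<Lambda>"
  shows "\<exists>!\<mu>. 0 < \<mu> \<and> H a p q z \<mu> = \<Lambda>"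
proof -
  define y where "y = \<Lambda> powr (1 / p)"
  have "y powr p = \<Lambda>"
    using assms by (simp add: y_def powr_powr)
  then have "\<Lambda> \<le> H a p q z y"
    using assms powr_le_H by metis
  moreover have "H a p q z 0 \<le> \<Lambda>"
    using assms by (simp add: H_def)
  moreover have "continuous_on {0..y} (H a p q z)"
    unfolding H_def[abs_def] using assms by (intro continuous_intros continuous_on_powr') auto
  ultimately obtain \<mu> where "0 \<le> \<mu>" and root: "H a p q z \<mu> = \<Lambda>"
    using IVT'[of "H a p q z" 0 \<Lambda> y] by (auto simp: y_def)
  moreover have "\<mu> \<noteq> 0"
    using root assms by (auto simp: H_def)
  moreover have "\<nu> = \<mu>" if "0 < \<nu>" "H a p q z \<nu> = \<Lambda>" for \<nu>
    using that root \<open>0 \<le> \<mu>\<close> assms H_strict_mono[of a z p q \<nu> \<mu>] H_strict_mono[of a z p q \<mu> \<nu>]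
    by (cases \<nu> \<mu> rule: linorder_cases) auto
  ultimately show ?thesis
    by (intro ex1I[of _ \<mu>]) auto
qed

lemma
  assumes "0 \<le> a z" "0 < p" "0 < q" "0 < \<Lambda>"
  shows lam_pos: "0 < lam a p q \<Lambda> z"
    and H_lam: "H a p q z (lam a p q \<Lambda> z) = \<Lambda>"
  using theI'[OF ex1_H_eq[of a z p q \<Lambda>, OF assms]] by (auto simp: lam_def H_def)

lemma
  assumes "0 \<le> a z" "p \<le> q" "0 \<le> s" "s \<le> 1" "0 \<le> x"
  shows H_scale_le: "H a p q z (s * x) \<le> s powr p * H a p q z x"
    and H_scale_ge: "s powr q * H a p q z x \<le> H a p q z (s * x)"
proof -
  have s: "s powr q \<le> s powr p"
    using assms by (intro powr_mono') auto
  have "H a p q z (s * x) = s powr p * x powr p + s powr q * (a z * x powr q)"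
    using assms by (simp add: H_def powr_mult)
  moreover have "s powr q * (a z * x powr q) \<le> s powr p * (a z * x powr q)"
    "s powr q * x powr p \<le> s powr p * x powr p"
    using s assms by (auto intro!: mult_right_mono)
  ultimately show "H a p q z (s * x) \<le> s powr p * H a p q z x"
    "s powr q * H a p q z x \<le> H a p q z (s * x)"
    by (simp_all add: H_def distrib_left)
qed

lemma powr_scale_le_of_H_le:
  assumes "0 \<le> a z" "0 < p" "p \<le> q" "0 < c" "c \<le> 1" "0 \<le> x" "0 \<le> y"
    and "c * H a p q z x \<le> H a p q z y"
  shows "c powr (1 / p) * x \<le> y"
proof (rule ccontr)
  define s where "s = c powr (1 / p)"
  have s: "0 \<le> s" "s \<le> 1" "s powr p = c"
    using assms by (auto simp: s_def powr_powr intro: powr_le1)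
  assume "\<not> c powr (1 / p) * x \<le> y"
  then have "H a p q z y < H a p q z (s * x)"
    using assms by (intro H_strict_mono) (auto simp: s_def)
  also have "\<dots> \<le> c * H a p q z x"
    using H_scale_le[of a z p q s x] s assms by simp
  finally show False
    using assms by simp
qed

lemma square_div_H_antimono:
  assumes "0 \<le> a z" "2 \<le> p" "p \<le> q" "0 < x" "x \<le> y"
  shows "y\<^sup>2 / H a p q z y \<le> x\<^sup>2 / H a p q z x"
proof -
  have quot: "H a p q z s / s\<^sup>2 = s powr (p - 2) + a z * s powr (q - 2)" if "0 < s" for s
    using that by (simp add: H_def powr_diff add_divide_distrib)
  have "H a p q z x / x\<^sup>2 \<le> H a p q z y / y\<^sup>2"
    using assms by (simp add: quot add_mono mult_left_mono powr_mono2)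
  then show ?thesis
    using assms H_pos[of a z] le_imp_inverse_le[of "H a p q z x / x\<^sup>2" "H a p q z y / y\<^sup>2"] by simp
qed

lemma square_div_H_le_of_H_le:
  assumes "0 \<le> a z" "2 \<le> p" "p \<le> q" "0 < c" "c \<le> 1" "0 < x" "0 < y"
    and "c * H a p q z x \<le> H a p q z y"
  shows "y\<^sup>2 / H a p q z y \<le> c powr ((2 - q) / p) * (x\<^sup>2 / H a p q z x)"
proof -
  define s where "s = c powr (1 / p)"
  have s: "0 < s" "s \<le> 1"
    using assms by (auto simp: s_def intro: powr_le1)
  have H: "0 < H a p q z x" "s powr q * H a p q z x \<le> H a p q z (s * x)"
    using assms s by (auto intro: H_pos H_scale_ge)
  have "s * x \<le> y"
    unfolding s_def using assms by (intro powr_scale_le_of_H_le) auto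
  then have "y\<^sup>2 / H a p q z y \<le> (s * x)\<^sup>2 / H a p q z (s * x)"
    using assms s by (intro square_div_H_antimono) auto
  also have "\<dots> \<le> (s * x)\<^sup>2 / (s powr q * H a p q z x)"
    using H s assms by (intro divide_left_mono mult_pos_pos H_pos) auto
  also have "\<dots> = s powr (2 - q) * (x\<^sup>2 / H a p q z x)"
    using s by (simp add: powr_diff power_mult_distrib)
  finally show ?thesis
    using assms by (simp add: s_def powr_powr)
qed

lemma
  assumes "0 \<le> a z" "0 < \<mu>"
  shows half_time_ge: "\<mu>\<^sup>2 / H a p q z \<mu> * r\<^sup>2 \<le> half_time a p q \<mu> r z"
    and half_time_le_powr: "half_time a p q \<mu> r z \<le> \<mu> powr (2 - p) * r\<^sup>2"
proof -
  have "\<mu>\<^sup>2 / H a p q z \<mu> \<le> \<mu>\<^sup>2 / \<mu> powr p"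
    using assms by (intro divide_left_mono mult_pos_pos powr_le_H H_pos) auto
  then have "\<mu>\<^sup>2 / H a p q z \<mu> * r\<^sup>2 \<le> \<mu> powr (2 - p) * r\<^sup>2"
    using assms by (intro mult_right_mono) (auto simp: powr_diff)
  then show "\<mu>\<^sup>2 / H a p q z \<mu> * r\<^sup>2 \<le> half_time a p q \<mu> r z"
    "half_time a p q \<mu> r z \<le> \<mu> powr (2 - p) * r\<^sup>2"
    by (simp_all add: half_time_def)
qed

lemma half_time_le:
  assumes "0 \<le> a z" "0 < \<mu>"
  shows "half_time a p q \<mu> r z \<le> 2 * (\<mu>\<^sup>2 / H a p q z \<mu>) * r\<^sup>2"
proof (cases "p_phase a p q \<mu> z")
  case True
  then have "H a p q z \<mu> / 2 \<le> \<mu> powr p"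
    by (simp add: p_phase_def H_def)
  then have "\<mu>\<^sup>2 / \<mu> powr p \<le> \<mu>\<^sup>2 / (H a p q z \<mu> / 2)"
    using assms H_pos[of a z \<mu> p q] by (intro divide_left_mono mult_pos_pos) auto
  then have "\<mu>\<^sup>2 / \<mu> powr p * r\<^sup>2 \<le> \<mu>\<^sup>2 / (H a p q z \<mu> / 2) * r\<^sup>2"
    by (intro mult_right_mono) auto
  then show ?thesis
    using True assms by (simp add: half_time_def powr_diff mult_ac)
next
  case False
  then have "half_time a p q \<mu> r z = \<mu>\<^sup>2 / H a p q z \<mu> * r\<^sup>2"
    by (simp add: half_time_def)
  moreover have "0 \<le> \<mu>\<^sup>2 / H a p q z \<mu> * r\<^sup>2"
    using H_pos[of a z \<mu> p q] assms by simp
  ultimately show ?thesis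
    by linarith
qed

lemma half_time_le_square:
  assumes "0 \<le> a z" "2 \<le> p" "1 \<le> \<mu>"
  shows "half_time a p q \<mu> r z \<le> r\<^sup>2"
proof -
  have "\<mu> powr (2 - p) \<le> 1"
    using assms powr_mono[of "2 - p" 0 \<mu>] by simp
  then have "\<mu> powr (2 - p) * r\<^sup>2 \<le> r\<^sup>2"
    by (simp add: mult_left_le_one_le)
  then show ?thesis
    using half_time_le_powr[of a z \<mu> p q r] assms by simp
qed

lemma half_time_diff_ge:
  assumes "0 \<le> a z" "0 < \<mu>" "0 \<le> r" "r \<le> R"
  shows "\<mu>\<^sup>2 / H a p q z \<mu> * (R - r)\<^sup>2 \<le> half_time a p q \<mu> R z - half_time a p q \<mu> r z"
proof -
  have "(R - r)\<^sup>2 \<le> R\<^sup>2 - r\<^sup>2"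
    using assms mult_left_mono[of r R r] by (simp add: power2_eq_square algebra_simps)
  moreover have "\<mu>\<^sup>2 / H a p q z \<mu> \<le> half_time a p q \<mu> 1 z"
    using half_time_ge[of a z \<mu> p q 1] assms by simp
  moreover have "0 \<le> \<mu>\<^sup>2 / H a p q z \<mu>"
    using H_pos[of a z \<mu> p q] assms by simp
  ultimately have "\<mu>\<^sup>2 / H a p q z \<mu> * (R - r)\<^sup>2 \<le> half_time a p q \<mu> 1 z * (R\<^sup>2 - r\<^sup>2)"
    by (intro mult_mono) auto
  also have "\<dots> = half_time a p q \<mu> R z - half_time a p q \<mu> r z"
    by (simp add: half_time_def algebra_simps)
  finally show ?thesis .
qed

lemma intr_cyl_eq_cyl: "intr_cyl a p q \<mu> r z = cyl z r (half_time a p q \<mu> r z)"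
  by (simp add: intr_cyl_def half_time_def Q_cyl_def G_cyl_def)

lemma cyl_mono: "r \<le> r' \<Longrightarrow> s \<le> s' \<Longrightarrow> cyl z r s \<subseteq> cyl z r' s'"
  by (auto simp: cyl_def)

lemma par_cyl_mono: "0 \<le> r \<Longrightarrow> r \<le> R \<Longrightarrow> par_cyl r z \<subseteq> par_cyl R z"
  unfolding par_cyl_def by (intro cyl_mono power_mono)

lemma intr_cyl_mono:
  assumes "0 \<le> a z" "0 < \<mu>" "0 \<le> r" "r \<le> R"
  shows "intr_cyl a p q \<mu> r z \<subseteq> intr_cyl a p q \<mu> R z"
proof -
  have "0 \<le> \<mu>\<^sup>2 / H a p q z \<mu> * (R - r)\<^sup>2"
    using H_pos[of a z \<mu> p q] assms by simp
  then show ?thesis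
    using half_time_diff_ge[of a z \<mu> r R p q] assms unfolding intr_cyl_eq_cyl
    by (intro cyl_mono) auto
qed

lemma intr_cyl_subset_par_cyl:
  assumes "0 \<le> a z" "2 \<le> p" "1 \<le> \<mu>"
  shows "intr_cyl a p q \<mu> r z \<subseteq> par_cyl r z"
  unfolding intr_cyl_eq_cyl par_cyl_def using assms by (intro cyl_mono half_time_le_square) auto

lemma centre_in_intr_cyl:
  assumes "0 \<le> a z" "0 < \<mu>" "0 < r"
  shows "z \<in> intr_cyl a p q \<mu> r z"
  using assms H_pos[of a z \<mu> p q]
  by (cases z) (auto simp: intr_cyl_eq_cyl cyl_def half_time_def)

lemma
  assumes "cyl z r \<tau> \<inter> strip t s1 \<noteq> {}" "\<not> cyl z r \<tau> \<subseteq> strip t s2"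
  shows radius_pos_of_crossing_strips: "0 < r"
    and strip_gap_less_of_crossing_strips: "s2 - s1 < 2 * \<tau>"
proof -
  obtain v w where v: "v \<in> cyl z r \<tau>" "v \<in> strip t s1" and w: "w \<in> cyl z r \<tau>" "w \<notin> strip t s2"
    using assms by blast
  show "0 < r"
    using v by (auto simp: cyl_def intro: le_less_trans[OF zero_le_dist])
  show "s2 - s1 < 2 * \<tau>"
    using v w by (cases v; cases w) (auto simp: cyl_def strip_def)
qed

lemma square_gap_le_of_crossing_strips:
  fixes a b :: "'n::finite spacetime \<Rightarrow> real" and p q :: real
  assumes "0 \<le> a z0" "0 < \<pi>" "0 \<le> R1" "R1 \<le> R2" "0 \<le> b z" "0 < \<mu>"
  defines "\<sigma>1 \<equiv> half_time a p q \<pi> R1 z0" and "\<sigma>2 \<equiv> half_time a p q \<pi> R2 z0"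
  assumes meets: "intr_cyl b p q \<mu> r z \<inter> strip t ((4 * \<sigma>1 + \<sigma>2) / 5) \<noteq> {}"
    and leaves: "\<not> intr_cyl b p q \<mu> r z \<subseteq> strip t ((3 * \<sigma>1 + 2 * \<sigma>2) / 5)"
  shows "\<pi>\<^sup>2 / H a p q z0 \<pi> * (R2 - R1)\<^sup>2 \<le> 20 * (\<mu>\<^sup>2 / H b p q z \<mu>) * r\<^sup>2"
proof -
  have "\<pi>\<^sup>2 / H a p q z0 \<pi> * (R2 - R1)\<^sup>2 \<le> \<sigma>2 - \<sigma>1"
    unfolding \<sigma>1_def \<sigma>2_def using assms by (intro half_time_diff_ge) auto
  also have "\<dots> \<le> 10 * half_time b p q \<mu> r z"
    using strip_gap_less_of_crossing_strips[OF meets[unfolded intr_cyl_eq_cyl] leaves[unfolded intr_cyl_eq_cyl]]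
    by (simp add: field_simps)
  also have "\<dots> \<le> 20 * (\<mu>\<^sup>2 / H b p q z \<mu>) * r\<^sup>2"
    using half_time_le[of b z \<mu> p q r] assms by simp
  finally show ?thesis .
qed

lemma Theta2_iff: "i \<in> Theta2 U C1 C2 \<longleftrightarrow> U i \<inter> C1 \<noteq> {} \<and> \<not> U i \<subseteq> C2"
  by (auto simp: Theta2_def Theta1_def Theta_def)

lemma extend_coeff_ge:
  assumes "Q \<noteq> {}" "\<And>w. w \<in> Q \<Longrightarrow> l \<le> a w"
  shows "l \<le> extend_coeff \<alpha> a\<^sub>\<alpha> Q a z"
  unfolding extend_coeff_def using assms by (intro max.coboundedI2 cINF_greatest) auto

lemma extend_coeff_le:
  assumes "Q \<noteq> {}" "bdd_below (a ` Q)" "\<And>w. w \<in> Q \<Longrightarrow> a w \<le> h"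
  shows "extend_coeff \<alpha> a\<^sub>\<alpha> Q a z \<le> h"
proof -
  obtain w where "w \<in> Q"
    using assms by auto
  then have "(INF w\<in>Q. a w) \<le> h"
    using assms(2,3) by (metis cINF_lower2)
  moreover have "(SUP w\<in>Q. a w) \<le> h"
    using assms by (intro cSUP_least) auto
  ultimately show ?thesis
    by (auto simp: extend_coeff_def)
qed

lemma H_extend_coeff_ge:
  assumes "Q \<noteq> {}" "0 < s" "\<And>w. w \<in> Q \<Longrightarrow> c \<le> H a p q w s"
  shows "c \<le> H (extend_coeff \<alpha> a\<^sub>\<alpha> Q a) p q z s"
proof -
  have "(c - s powr p) / s powr q \<le> extend_coeff \<alpha> a\<^sub>\<alpha> Q a z"
    using assms by (intro extend_coeff_ge) (auto simp: H_def field_simps)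
  then show ?thesis
    using assms by (simp add: H_def field_simps)
qed

lemma H_extend_coeff_le:
  assumes "Q \<noteq> {}" "bdd_below (a ` Q)" "0 < s" "\<And>w. w \<in> Q \<Longrightarrow> H a p q w s \<le> c"
  shows "H (extend_coeff \<alpha> a\<^sub>\<alpha> Q a) p q z s \<le> c"
proof -
  have "extend_coeff \<alpha> a\<^sub>\<alpha> Q a z \<le> (c - s powr p) / s powr q"
    using assms by (intro extend_coeff_le) (auto simp: H_def field_simps)
  then show ?thesis
    using assms by (simp add: H_def field_simps)
qed

lemma admissible_coefficient_nonneg:
  "admissible_coefficient \<alpha> a\<^sub>\<alpha> S a \<Longrightarrow> z \<in> S \<Longrightarrow> 0 \<le> a z"
  by (simp add: admissible_coefficient_def)

lemma admissible_coefficient_par_cyl_le: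
  assumes "admissible_coefficient \<alpha> a\<^sub>\<alpha> S a" "0 \<le> \<alpha>" "0 \<le> a\<^sub>\<alpha>" "0 \<le> r"
    and z: "z \<in> S" and w: "w \<in> S" "w \<in> par_cyl r z"
  shows "\<bar>a w - a z\<bar> \<le> a\<^sub>\<alpha> * r powr \<alpha>"
proof -
  have "norm (fst w - fst z) \<le> r" and time: "\<bar>snd w - snd z\<bar> \<le> r\<^sup>2"
    using w by (auto simp: par_cyl_def cyl_def dist_norm norm_minus_commute)
  then have "norm (fst w - fst z) powr \<alpha> \<le> r powr \<alpha>"
    using assms by (intro powr_mono2) auto
  moreover have "\<bar>snd w - snd z\<bar> powr (\<alpha> / 2) \<le> (r\<^sup>2) powr (\<alpha> / 2)"
    using time assms(2) by (intro powr_mono2) auto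
  moreover have "(r\<^sup>2) powr (\<alpha> / 2) = r powr \<alpha>"
    using assms(4) powr_powr[of r 2 "\<alpha> / 2"] by simp
  ultimately have "a\<^sub>\<alpha> * max (norm (fst w - fst z) powr \<alpha>) (\<bar>snd w - snd z\<bar> powr (\<alpha> / 2))
      \<le> a\<^sub>\<alpha> * r powr \<alpha>"
    using assms by (intro mult_left_mono) auto
  moreover have "\<bar>a w - a z\<bar> \<le>
      a\<^sub>\<alpha> * max (norm (fst w - fst z) powr \<alpha>) (\<bar>snd w - snd z\<bar> powr (\<alpha> / 2))"
    using assms(1) z w(1) by (simp add: admissible_coefficient_def case_prod_beta)
  ultimately show ?thesis
    by linarith
qed

locale intrinsic_cylinder =
  fixes p q \<alpha> a\<^sub>\<alpha> \<delta> :: real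
    and S :: "'n::finite spacetime set" and a :: "'n spacetime \<Rightarrow> real"
    and F Du :: "'n spacetime \<Rightarrow> real^'n^'m::finite"
    and z0 :: "'n spacetime" and \<rho> \<pi> :: real
  assumes \<alpha>: "0 < \<alpha>" "\<alpha> \<le> 1" and p: "2 < p" and a\<^sub>\<alpha>_nonneg: "0 \<le> a\<^sub>\<alpha>"
    and admissible: "admissible_coefficient \<alpha> a\<^sub>\<alpha> S a"
    and z0_in_S: "z0 \<in> S" and \<rho>_pos: "0 < \<rho>" and \<pi>_gt_1: "1 < \<pi>"
    and intrinsic: "p_intrinsic p q \<alpha> \<delta> S a F Du z0 \<rho> \<pi> \<or> pq_intrinsic p q \<delta> S a F Du z0 \<rho> \<pi>"
begin

abbreviation a_ext :: "real \<Rightarrow> 'n spacetime \<Rightarrow> real" where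
  "a_ext R \<equiv> extend_coeff \<alpha> a\<^sub>\<alpha> (intr_cyl a p q \<pi> R z0) a"

lemma a_z0_nonneg: "0 \<le> a z0"
  using admissible z0_in_S by (rule admissible_coefficient_nonneg)

lemma H_z0_pos: "0 < H a p q z0 \<pi>"
  using a_z0_nonneg \<pi>_gt_1 by (intro H_pos) auto

lemma intr_cyl_subset_domain:
  assumes "0 \<le> R" "R \<le> 16 * \<rho>"
  shows "intr_cyl a p q \<pi> R z0 \<subseteq> S"
proof -
  have "intr_cyl a p q \<pi> (16 * \<rho>) z0 \<subseteq> S"
    using intrinsic by (auto simp: p_intrinsic_def pq_intrinsic_def Let_def intr_cyl_def p_phase_def)
  then show ?thesis
    using intr_cyl_mono[of a z0 \<pi> R "16 * \<rho>" p q] assms a_z0_nonneg \<pi>_gt_1 by auto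
qed

lemma intr_cyl_z0_subset_par_cyl:
  assumes "0 \<le> R" "R \<le> r"
  shows "intr_cyl a p q \<pi> R z0 \<subseteq> par_cyl r z0"
  using intr_cyl_subset_par_cyl[of a z0 p \<pi> q R] par_cyl_mono[OF assms, of z0] a_z0_nonneg p \<pi>_gt_1
  by auto

lemma p_intrinsic_coeff_le:
  assumes "p_intrinsic p q \<alpha> \<delta> S a F Du z0 \<rho> \<pi>" "w \<in> S" "w \<in> par_cyl (4 * \<rho>) z0"
  shows "a w * \<pi> powr q \<le> (1 + 4 * a\<^sub>\<alpha>) * \<pi> powr p"
proof -
  have phase: "a z0 * \<pi> powr q \<le> \<pi> powr p" and radius: "\<rho> powr \<alpha> \<le> \<pi> powr (p - q)"
    using assms by (auto simp: p_intrinsic_def Let_def)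
  have "(4 * \<rho>) powr \<alpha> \<le> 4 * \<rho> powr \<alpha>"
    using \<alpha> \<rho>_pos powr_mono[of \<alpha> 1 "4::real"] by (auto simp: powr_mult intro!: mult_right_mono)
  also have "\<dots> \<le> 4 * \<pi> powr (p - q)"
    using radius by simp
  finally have "a\<^sub>\<alpha> * (4 * \<rho>) powr \<alpha> \<le> a\<^sub>\<alpha> * (4 * \<pi> powr (p - q))"
    using a\<^sub>\<alpha>_nonneg by (intro mult_left_mono)
  then have "a w \<le> a z0 + a\<^sub>\<alpha> * (4 * \<pi> powr (p - q))"
    using admissible_coefficient_par_cyl_le[OF admissible, of "4 * \<rho>" z0 w]
      \<alpha> a\<^sub>\<alpha>_nonneg \<rho>_pos z0_in_S assms by force
  then have "a w * \<pi> powr q \<le> (a z0 + a\<^sub>\<alpha> * (4 * \<pi> powr (p - q))) * \<pi> powr q"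
    by (intro mult_right_mono) auto
  also have "\<dots> = a z0 * \<pi> powr q + 4 * a\<^sub>\<alpha> * \<pi> powr p"
    using \<pi>_gt_1 by (simp add: powr_diff distrib_right)
  finally show ?thesis
    using phase by (simp add: distrib_right)
qed

lemma pq_intrinsic_coeff_comparable:
  assumes "pq_intrinsic p q \<delta> S a F Du z0 \<rho> \<pi>" "w \<in> S" "w \<in> par_cyl (10 * \<rho>) z0"
  shows "a z0 * \<pi> powr q / 2 \<le> a w * \<pi> powr q" "a w * \<pi> powr q \<le> 2 * (a z0 * \<pi> powr q)"
proof -
  have "a z0 / 2 \<le> a w" "a w \<le> 2 * a z0"
    using assms by (auto simp: pq_intrinsic_def Let_def)
  then show "a z0 * \<pi> powr q / 2 \<le> a w * \<pi> powr q" "a w * \<pi> powr q \<le> 2 * (a z0 * \<pi> powr q)"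
    using mult_right_mono[of _ _ "\<pi> powr q"] by fastforce+
qed

lemma H_comparable_lower:
  assumes "0 < R" "R \<le> 4 * \<rho>" "w \<in> intr_cyl a p q \<pi> R z0"
  shows "H a p q z0 \<pi> / 2 \<le> H a p q w \<pi>"
  using intrinsic
proof
  assume "p_intrinsic p q \<alpha> \<delta> S a F Du z0 \<rho> \<pi>"
  then have "H a p q z0 \<pi> / 2 \<le> \<pi> powr p"
    by (auto simp: p_intrinsic_def Let_def H_def)
  also have "\<dots> \<le> H a p q w \<pi>"
    using assms \<rho>_pos intr_cyl_subset_domain[of R]
    by (intro powr_le_H admissible_coefficient_nonneg[OF admissible]) auto
  finally show ?thesis .
next
  assume "pq_intrinsic p q \<delta> S a F Du z0 \<rho> \<pi>"
  then have "a z0 * \<pi> powr q / 2 \<le> a w * \<pi> powr q"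
    using assms \<rho>_pos intr_cyl_subset_domain[of R] intr_cyl_z0_subset_par_cyl[of R "10 * \<rho>"]
    by (intro pq_intrinsic_coeff_comparable) auto
  then show ?thesis
    using powr_ge_zero[of \<pi> p] by (simp add: H_def del: powr_ge_zero)
qed

lemma H_comparable_upper:
  assumes "0 < R" "R \<le> 4 * \<rho>" "w \<in> intr_cyl a p q \<pi> R z0"
  shows "H a p q w \<pi> \<le> (2 + 4 * a\<^sub>\<alpha>) * H a p q z0 \<pi>"
  using intrinsic
proof
  assume "p_intrinsic p q \<alpha> \<delta> S a F Du z0 \<rho> \<pi>"
  then have "a w * \<pi> powr q \<le> (1 + 4 * a\<^sub>\<alpha>) * \<pi> powr p"
    using assms \<rho>_pos intr_cyl_subset_domain[of R] intr_cyl_z0_subset_par_cyl[of R "4 * \<rho>"]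
    by (intro p_intrinsic_coeff_le) auto
  then have "H a p q w \<pi> \<le> (2 + 4 * a\<^sub>\<alpha>) * \<pi> powr p"
    by (simp add: H_def algebra_simps)
  also have "\<dots> \<le> (2 + 4 * a\<^sub>\<alpha>) * H a p q z0 \<pi>"
    using a\<^sub>\<alpha>_nonneg a_z0_nonneg by (intro mult_left_mono powr_le_H) auto
  finally show ?thesis .
next
  assume "pq_intrinsic p q \<delta> S a F Du z0 \<rho> \<pi>"
  then have "a w * \<pi> powr q \<le> 2 * (a z0 * \<pi> powr q)"
    using assms \<rho>_pos intr_cyl_subset_domain[of R] intr_cyl_z0_subset_par_cyl[of R "10 * \<rho>"]
    by (intro pq_intrinsic_coeff_comparable) auto
  then have "H a p q w \<pi> \<le> 2 * H a p q z0 \<pi>"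
    using powr_ge_zero[of \<pi> p] by (simp add: H_def del: powr_ge_zero)
  also have "\<dots> \<le> (2 + 4 * a\<^sub>\<alpha>) * H a p q z0 \<pi>"
    using a\<^sub>\<alpha>_nonneg H_z0_pos by (intro mult_right_mono) auto
  finally show ?thesis .
qed

lemma
  assumes R: "0 < R" "R \<le> 4 * \<rho>"
  shows a_ext_nonneg: "0 \<le> a_ext R z"
    and H_a_ext_lower: "H a p q z0 \<pi> / 2 \<le> H (a_ext R) p q z \<pi>"
    and H_a_ext_upper: "H (a_ext R) p q z \<pi> \<le> (2 + 4 * a\<^sub>\<alpha>) * H a p q z0 \<pi>"
proof -
  have nonempty: "intr_cyl a p q \<pi> R z0 \<noteq> {}"
    using centre_in_intr_cyl[of a z0 \<pi> R p q] R a_z0_nonneg \<pi>_gt_1 by auto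
  have nonneg: "0 \<le> a w" if "w \<in> intr_cyl a p q \<pi> R z0" for w
    using that intr_cyl_subset_domain[of R] R \<rho>_pos
    by (intro admissible_coefficient_nonneg[OF admissible]) auto
  then have bdd: "bdd_below (a ` intr_cyl a p q \<pi> R z0)"
    by (rule bdd_belowI2)
  show "0 \<le> a_ext R z"
    using nonempty nonneg by (rule extend_coeff_ge)
  show "H a p q z0 \<pi> / 2 \<le> H (a_ext R) p q z \<pi>"
    using nonempty \<pi>_gt_1 R by (intro H_extend_coeff_ge H_comparable_lower) auto
  show "H (a_ext R) p q z \<pi> \<le> (2 + 4 * a\<^sub>\<alpha>) * H a p q z0 \<pi>"
    using nonempty bdd \<pi>_gt_1 R by (intro H_extend_coeff_le H_comparable_upper) auto
qed

lemma
  assumes R: "0 < R" "R \<le> 4 * \<rho>" and "p \<le> q" "0 < \<theta>" "\<theta> * H a p q z0 \<pi> \<le> \<Lambda>"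
  shows lam_a_ext_pos: "0 < lam (a_ext R) p q \<Lambda> z"
    and H_lam_a_ext: "H (a_ext R) p q z (lam (a_ext R) p q \<Lambda> z) = \<Lambda>"
proof -
  have "0 < \<Lambda>"
    using assms H_z0_pos by (meson less_le_trans mult_pos_pos)
  then show "0 < lam (a_ext R) p q \<Lambda> z" "H (a_ext R) p q z (lam (a_ext R) p q \<Lambda> z) = \<Lambda>"
    using a_ext_nonneg[OF R, of z] p \<open>p \<le> q\<close> by (auto intro!: lam_pos H_lam)
qed

lemma lam_a_ext_square_div_le:
  assumes R: "0 < R" "R \<le> 4 * \<rho>" and "p \<le> q" and \<theta>: "0 < \<theta>" "\<theta> \<le> 1"
    and \<Lambda>: "\<theta> * H a p q z0 \<pi> \<le> \<Lambda>"
  shows "(lam (a_ext R) p q \<Lambda> z)\<^sup>2 / \<Lambda>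
    \<le> 2 * ((2 + 4 * a\<^sub>\<alpha>) powr ((q - 2) / p) * \<theta> powr ((2 - q) / p)) * (\<pi>\<^sup>2 / H a p q z0 \<pi>)"
proof -
  define K where "K = 2 + 4 * a\<^sub>\<alpha>"
  have K: "2 \<le> K"
    using a\<^sub>\<alpha>_nonneg by (simp add: K_def)
  note lam = lam_a_ext_pos[OF R \<open>p \<le> q\<close> \<theta>(1) \<Lambda>] H_lam_a_ext[OF R \<open>p \<le> q\<close> \<theta>(1) \<Lambda>]
  have "\<theta> / K * H (a_ext R) p q z \<pi> \<le> \<theta> / K * (K * H a p q z0 \<pi>)"
    unfolding K_def using R \<theta> a\<^sub>\<alpha>_nonneg by (intro mult_left_mono H_a_ext_upper) auto
  also have "\<dots> \<le> \<Lambda>"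
    using \<Lambda> K by simp
  finally have "(lam (a_ext R) p q \<Lambda> z)\<^sup>2 / \<Lambda>
      \<le> (\<theta> / K) powr ((2 - q) / p) * (\<pi>\<^sup>2 / H (a_ext R) p q z \<pi>)"
    using square_div_H_le_of_H_le[of "a_ext R" z p q "\<theta> / K" \<pi> "lam (a_ext R) p q \<Lambda> z"]
      a_ext_nonneg[OF R, of z] lam p \<open>p \<le> q\<close> \<theta> K \<pi>_gt_1 by simp
  also have "\<dots> \<le> (\<theta> / K) powr ((2 - q) / p) * (\<pi>\<^sup>2 / (H a p q z0 \<pi> / 2))"
    using H_a_ext_lower[OF R, of z] H_z0_pos by (intro mult_left_mono divide_left_mono) auto
  also have "(\<theta> / K) powr ((2 - q) / p) = K powr ((q - 2) / p) * \<theta> powr ((2 - q) / p)"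
    using \<theta> K powr_minus_divide[of K "(q - 2) / p"] by (simp add: powr_divide minus_divide_left)
  finally show ?thesis
    by (simp add: K_def mult_ac)
qed

lemma radius_gap_le:
  fixes r :: real and z :: "'n spacetime"
  assumes radii: "0 \<le> R1" "R1 < R2" "R2 \<le> 4 * \<rho>" and "p \<le> q" and \<theta>: "0 < \<theta>" "\<theta> \<le> 1"
    and \<Lambda>: "\<theta> * H a p q z0 \<pi> \<le> \<Lambda>"
  defines "\<sigma>1 \<equiv> half_time a p q \<pi> R1 z0" and "\<sigma>2 \<equiv> half_time a p q \<pi> R2 z0"
    and "U \<equiv> intr_cyl (a_ext R2) p q (lam (a_ext R2) p q \<Lambda> z) (50 * r) z"
  assumes meets: "U \<inter> strip t ((4 * \<sigma>1 + \<sigma>2) / 5) \<noteq> {}"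
    and leaves: "\<not> U \<subseteq> strip t ((3 * \<sigma>1 + 2 * \<sigma>2) / 5)"
  shows "R2 - R1 \<le> 400 * (2 + 4 * a\<^sub>\<alpha>) powr ((q - 2) / p) * \<theta> powr ((2 - q) / p) * r"
proof -
  define X where "X = (2 + 4 * a\<^sub>\<alpha>) powr ((q - 2) / p) * \<theta> powr ((2 - q) / p)"
  have "1 \<le> (2 + 4 * a\<^sub>\<alpha>) powr ((q - 2) / p)"
    using a\<^sub>\<alpha>_nonneg p \<open>p \<le> q\<close> by (intro ge_one_powr_ge_zero) auto
  moreover have "1 \<le> \<theta> powr ((2 - q) / p)"
    using p \<open>p \<le> q\<close> \<theta> powr_mono'[of "(2 - q) / p" 0 \<theta>] by (simp add: divide_nonpos_pos)
  ultimately have "1 \<le> X"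
    unfolding X_def by (rule mult_ge1_I)
  have "0 < 50 * r"
    using meets leaves unfolding U_def intr_cyl_eq_cyl by (rule radius_pos_of_crossing_strips)
  have R2: "0 < R2" "R2 \<le> 4 * \<rho>"
    using radii by auto
  define \<mu> where "\<mu> = lam (a_ext R2) p q \<Lambda> z"
  have \<mu>: "0 < \<mu>" "H (a_ext R2) p q z \<mu> = \<Lambda>"
    unfolding \<mu>_def using R2 \<open>p \<le> q\<close> \<theta>(1) \<Lambda> by (rule lam_a_ext_pos H_lam_a_ext)+
  have "\<pi>\<^sup>2 / H a p q z0 \<pi> * (R2 - R1)\<^sup>2 \<le> 20 * (\<mu>\<^sup>2 / \<Lambda>) * (50 * r)\<^sup>2"
    using square_gap_le_of_crossing_strips[of a z0 \<pi> R1 R2 "a_ext R2" z \<mu> p q "50 * r" t]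
      meets leaves \<mu> radii a_z0_nonneg \<pi>_gt_1 a_ext_nonneg[OF R2, of z]
    by (simp add: U_def \<sigma>1_def \<sigma>2_def \<mu>_def)
  also have "\<dots> \<le> 20 * (2 * X * (\<pi>\<^sup>2 / H a p q z0 \<pi>)) * (50 * r)\<^sup>2"
    unfolding \<mu>_def X_def using R2 \<open>p \<le> q\<close> \<theta> \<Lambda>
    by (intro mult_right_mono mult_left_mono lam_a_ext_square_div_le) auto
  also have "\<dots> = \<pi>\<^sup>2 / H a p q z0 \<pi> * (100000 * X * r\<^sup>2)"
    by (simp add: power_mult_distrib)
  finally have "(R2 - R1)\<^sup>2 \<le> 100000 * X * r\<^sup>2"
    using H_z0_pos \<pi>_gt_1 by (subst (asm) mult_le_cancel_left_pos) auto
  also have "\<dots> \<le> 160000 * (X * X) * r\<^sup>2"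
    using \<open>1 \<le> X\<close> by (intro mult_right_mono) auto
  also have "\<dots> = (400 * X * r)\<^sup>2"
    by (simp add: power2_eq_square)
  finally have "R2 - R1 \<le> 400 * X * r"
    by (rule power2_le_imp_le) (use \<open>1 \<le> X\<close> \<open>0 < 50 * r\<close> in simp)
  then show ?thesis
    by (simp add: X_def mult.assoc)
qed

end

theorem lemma3p8:
  fixes p q \<alpha> L1 L2 a\<^sub>\<alpha> :: real
  assumes "CARD('n::finite) \<ge> 2"
    and "0 < \<alpha>" "\<alpha> \<le> 1"
    and "2 < p" "p < q" "q < p + 2 * \<alpha> / (real CARD('n) + 2)"
    and "0 < L1" "L1 \<le> L2"
    and "0 \<le> a\<^sub>\<alpha>"
  shows "\<exists>c \<ge> 1. \<forall>(\<Omega> :: (real^'n) set) (T :: real) (a :: 'n spacetime \<Rightarrow> real)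
      (A :: 'n spacetime \<Rightarrow> real^'n^'m::finite \<Rightarrow> real^'n^'m) (F :: 'n spacetime \<Rightarrow> real^'n^'m)
      (u :: 'n spacetime \<Rightarrow> real^'m) (Du :: 'n spacetime \<Rightarrow> real^'n^'m) (\<delta> :: real)
      (z0 :: 'n spacetime) (\<rho> :: real) (\<pi> :: real) (\<rho>1 :: real) (\<rho>2 :: real)
      (\<theta> :: real) (\<Lambda> :: real) (\<zeta> :: nat \<Rightarrow> 'n spacetime).
    open \<Omega> \<and> connected \<Omega> \<and> \<Omega> \<noteq> {} \<and> bounded \<Omega> \<and> 0 < T \<and>
    admissible_coefficient \<alpha> a\<^sub>\<alpha> (\<Omega> \<times> {0<..<T}) a \<and>
    caratheodory (\<Omega> \<times> {0<..<T}) A \<and>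
    double_phase_growth p q L1 L2 (\<Omega> \<times> {0<..<T}) a A \<and>
    F \<in> borel_measurable (lebesgue_on (\<Omega> \<times> {0<..<T})) \<and>
    set_integrable lebesgue (\<Omega> \<times> {0<..<T}) (\<lambda>z. H a p q z (norm (F z))) \<and>
    0 < \<delta> \<and> \<delta> < 1 \<and> (q - 1) / p < \<delta> \<and> 2 - q * (1 - \<delta>) > 0 \<and>
    very_weak_solution p q \<delta> \<Omega> T a A F u Du \<and>
    z0 \<in> \<Omega> \<times> {0<..<T} \<and> 0 < \<rho> \<and> 1 < \<pi> \<and>
    (p_intrinsic p q \<alpha> \<delta> (\<Omega> \<times> {0<..<T}) a F Du z0 \<rho> \<pi> \<or>
     pq_intrinsic p q \<delta> (\<Omega> \<times> {0<..<T}) a F Du z0 \<rho> \<pi>) \<and>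
    \<rho> \<le> \<rho>1 \<and> \<rho>1 < \<rho>2 \<and> \<rho>2 \<le> 4 * \<rho> \<and>
    0 < \<theta> \<and> \<theta> < 1 \<and> \<theta> * H a p q z0 \<pi> \<le> \<Lambda>
    \<longrightarrow>
    (let Q2 = intr_cyl a p q \<pi> \<rho>2 z0;
         \<sigma>1 = half_time a p q \<pi> \<rho>1 z0;
         \<sigma>2 = half_time a p q \<pi> \<rho>2 z0;
         ae = extend_coeff \<alpha> a\<^sub>\<alpha> Q2 a;
         E = good_set p q ae (g_fun u Du F \<rho> Q2) \<Lambda>;
         U50 = (\<lambda>i. whitney_cyl ae p q \<Lambda> E 50 (\<zeta> i));
         C1 = strip (snd z0) ((4 * \<sigma>1 + \<sigma>2) / 5);
         C2 = strip (snd z0) ((3 * \<sigma>1 + 2 * \<sigma>2) / 5)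
     in - E \<noteq> {} \<and> (\<forall>z \<in> - E. 1 < lam ae p q \<Lambda> z) \<and>
        whitney_covering ae p q \<alpha> a\<^sub>\<alpha> \<Lambda> E \<zeta> \<longrightarrow>
        (\<forall>i \<in> Theta2 U50 C1 C2. U50 i \<inter> Q2 \<noteq> {} \<longrightarrow>
           \<rho>2 - \<rho>1 \<le> c * \<theta> powr ((2 - q) / p) * whitney_radius ae p q \<Lambda> E (\<zeta> i)))"
proof (intro exI[of _ "400 * (2 + 4 * a\<^sub>\<alpha>) powr ((q - 2) / p)"] conjI allI impI, goal_cases)
  case 1
  have "1 \<le> (2 + 4 * a\<^sub>\<alpha>) powr ((q - 2) / p)"
    using assms by (intro ge_one_powr_ge_zero) auto
  then show ?case
    by simp
next
  case (2 \<Omega> T a A F u Du \<delta> z0 \<rho> \<pi> \<rho>1 \<rho>2 \<theta> \<Lambda> \<zeta>)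
  then interpret intrinsic_cylinder p q \<alpha> a\<^sub>\<alpha> \<delta> "\<Omega> \<times> {0<..<T}" a F Du z0 \<rho> \<pi>
    using assms by unfold_locales auto
  have "0 \<le> \<rho>1" "\<rho>1 < \<rho>2" "\<rho>2 \<le> 4 * \<rho>" "p \<le> q" "0 < \<theta>" "\<theta> \<le> 1" "\<theta> * H a p q z0 \<pi> \<le> \<Lambda>"
    using 2 assms by auto
  note gap = radius_gap_le[OF this]
  show ?case
    unfolding Let_def whitney_cyl_def
    by (intro impI ballI) (simp only: Theta2_iff, elim conjE, rule gap)
qed

end
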